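(* Let $X$ be a metric space satisfying $\mathsf{S}_{fin}(\mathcal{O}_X,\mathcal{O}_X)$, and let $Y$ be a subspace of $X$. The following are equivalent: (1) $\mathsf{S}_1(\mathcal{O}_X,\mathcal{O}_{XY})$ holds. (2) $M'(X,Y)$ holds.
   Context: $\mathcal{O}_X$ denotes the collection of all open covers of $X$, and $\mathcal{O}_{XY}$ denotes the collection of all covers of $Y$ by sets open in $X$. For families $\mathcal{A},\mathcal{B}$ of collections of sets: $\mathsf{S}_{fin}(\mathcal{A},\mathcal{B})$ states that for each sequence $(\mathcal{U}_n:n\in\mathbb{N})$ of members of $\mathcal{A}$ there are finite sets $\mathcal{F}_n\subseteq\mathcal{U}_n$ ($n\in\mathbb{N}$) such that $\bigcup_n\mathcal{F}_n\in\mathcal{B}$; $\mathsf{S}_1(\mathcal{A},\mathcal{B})$ states that for each sequence $(\mathcal{U}_n:n\in\mathbb{N})$ of members of $\mathcal{A}$ there are $U_n\in\mathcal{U}_n$ ($n\in\mathbb{N}$) such that $\{U_n:n\in\mathbb{N}\}\in\mathcal{B}$. $M'(X,Y)$ states that for each basis $\mathcal{B}$ of the topology of the metric space $X$ and each sequence $(\epsilon_n:n\in\mathbb{N})$ of positive real numbers there is a sequence $(B_n:n\in\mathbb{N})$ of elements of $\mathcal{B}$ such that $\mathrm{diam}(B_n)<\epsilon_n$ for each $n$, and $\{B_n:n\in\mathbb{N}\}$ covers $Y$. *)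

theory Defs
  imports "HOL-Analysis.Analysis"
begin

definition open_covers :: "'a topology \<Rightarrow> 'a set set set" where
  "open_covers T = {\<U>. (\<forall>U\<in>\<U>. openin T U) \<and> \<Union>\<U> = topspace T}"

definition open_covers_of_subset :: "'a topology \<Rightarrow> 'a set \<Rightarrow> 'a set set set" where
  "open_covers_of_subset T Y = {\<U>. (\<forall>U\<in>\<U>. openin T U) \<and> Y \<subseteq> \<Union>\<U>}"

definition S_fin :: "'a set set set \<Rightarrow> 'a set set set \<Rightarrow> bool" where
  "S_fin \<A> \<B> \<longleftrightarrow>
     (\<forall>\<U> :: nat \<Rightarrow> 'a set set. (\<forall>n. \<U> n \<in> \<A>) \<longrightarrow>
        (\<exists>\<F> :: nat \<Rightarrow> 'a set set. (\<forall>n. finite (\<F> n) \<and> \<F> n \<subseteq> \<U> n) \<and> (\<Union>n. \<F> n) \<in> \<B>))"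

definition S_one :: "'a set set set \<Rightarrow> 'a set set set \<Rightarrow> bool" where
  "S_one \<A> \<B> \<longleftrightarrow>
     (\<forall>\<U> :: nat \<Rightarrow> 'a set set. (\<forall>n. \<U> n \<in> \<A>) \<longrightarrow>
        (\<exists>U :: nat \<Rightarrow> 'a set. (\<forall>n. U n \<in> \<U> n) \<and> range U \<in> \<B>))"

text \<open>The version of \<open>topological_basis\<close> for topologies with an explicit carrier.\<close>

definition basis_of_topology :: "'a topology \<Rightarrow> 'a set set \<Rightarrow> bool" where
  "basis_of_topology T \<B> \<longleftrightarrow>
     (\<forall>B\<in>\<B>. openin T B) \<and> (\<forall>W. openin T W \<longrightarrow> (\<exists>\<B>'. \<B>' \<subseteq> \<B> \<and> \<Union>\<B>' = W))"

text \<open>The supremum is taken in \<open>ennreal\<close>, so that unbounded sets have diameter \<open>\<infinity>\<close>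
  (with \<open>diameter\<close> the supremum in the reals is unspecified for them) and the empty set
  has diameter \<open>0\<close>.\<close>

definition diam :: "'a metric \<Rightarrow> 'a set \<Rightarrow> ennreal" where
  "diam X S = (SUP (x, y) \<in> S \<times> S. ennreal (mdist X x y))"

definition M_prime :: "'a metric \<Rightarrow> 'a set \<Rightarrow> bool" where
  "M_prime X Y \<longleftrightarrow>
     (\<forall>\<B> (\<epsilon> :: nat \<Rightarrow> real). basis_of_topology (mtopology_of X) \<B> \<and> (\<forall>n. \<epsilon> n > 0) \<longrightarrow>
        (\<exists>B :: nat \<Rightarrow> 'a set.
           (\<forall>n. B n \<in> \<B> \<and> diam X (B n) < ennreal (\<epsilon> n)) \<and> Y \<subseteq> (\<Union>n. B n)))"

end

theory Submission
  imports Defs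
begin

text \<open>
  For (2) \<open>\<Longrightarrow>\<close> (1), let \<open>\<W> m\<close> be the cover by the nonempty open sets of diameter less than
  \<open>1 / (m + 1)\<close> that lie inside a member of each of \<open>\<U> 0, \<dots>, \<U> m\<close>. The Menger property, applied to
  every tail of \<open>\<W>\<close>, yields finite \<open>\<F> m \<subseteq> \<W> m\<close> such that every point is covered by \<open>\<F> m\<close>
  for infinitely many \<open>m\<close>; hence \<open>\<Union>m. \<F> m\<close> is a basis. Let \<open>\<epsilon> n\<close> be a lower bound for the
  finitely many positive diameters of members of \<open>\<F> 0, \<dots>, \<F> (n - 1)\<close>. A basis element of
  diameter less than \<open>\<epsilon> n\<close> is then a singleton or belongs to some \<open>\<F> m\<close> with \<open>m \<ge> n\<close>; either
  way it lies inside a member of \<open>\<U> n\<close>.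
\<close>

section \<open>Open sets, covers and bases in pointwise form\<close>

lemma openin_mtopology_of:
  "openin (mtopology_of X) U \<longleftrightarrow>
     U \<subseteq> mspace X \<and> (\<forall>x\<in>U. \<exists>r>0. mball_of X x r \<subseteq> U)"
  by (auto simp: mtopology_of_def mball_of_def
      Metric_space.openin_mtopology[OF Metric_space_mspace_mdist])

lemma openin_mball_of: "openin (mtopology_of X) (mball_of X x r)"
  by (simp add: mtopology_of_def mball_of_def
      Metric_space.openin_mball[OF Metric_space_mspace_mdist])

lemma in_open_covers_iff:
  "\<U> \<in> open_covers T \<longleftrightarrow> (\<forall>U\<in>\<U>. openin T U) \<and> (\<forall>x\<in>topspace T. \<exists>U\<in>\<U>. x \<in> U)"
proof -
  have "\<Union>\<U> = topspace T \<longleftrightarrow> topspace T \<subseteq> \<Union>\<U>" if "\<forall>U\<in>\<U>. openin T U"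
    using that by (simp add: set_eq_subset Sup_le_iff openin_subset)
  then show ?thesis
    unfolding open_covers_def by (auto simp: subset_iff)
qed

lemma basis_of_topology_iff:
  "basis_of_topology T \<B> \<longleftrightarrow>
     (\<forall>B\<in>\<B>. openin T B) \<and> (\<forall>W x. openin T W \<and> x \<in> W \<longrightarrow> (\<exists>B\<in>\<B>. x \<in> B \<and> B \<subseteq> W))"
  (is "_ \<longleftrightarrow> ?open \<and> ?local")
proof
  assume "basis_of_topology T \<B>"
  then show "?open \<and> ?local"
    unfolding basis_of_topology_def by blast
next
  assume *: "?open \<and> ?local"
  show "basis_of_topology T \<B>"
    unfolding basis_of_topology_def
  proof (intro conjI allI impI exI)
    show "\<Union>{B \<in> \<B>. B \<subseteq> W} = W" if "openin T W" for W
      using * that by blast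
  qed (use * in auto)
qed

section \<open>Diameters and small neighbourhoods\<close>

lemma mdist_le_diam: "x \<in> S \<Longrightarrow> y \<in> S \<Longrightarrow> ennreal (mdist X x y) \<le> diam X S"
  unfolding diam_def by (rule SUP_upper2[of "(x, y)"]) auto

lemma diam_mono: "S \<subseteq> T \<Longrightarrow> diam X S \<le> diam X T"
  unfolding diam_def by (intro SUP_subset_mono) auto

lemma diam_mball_of_le: "diam X (mball_of X x r) \<le> ennreal (2 * r)"
  unfolding diam_def
proof (rule SUP_least, clarify)
  fix y z
  assume yz: "y \<in> mball_of X x r" "z \<in> mball_of X x r"
  then have "mdist X y z \<le> mdist X y x + mdist X x z"
    by (intro mdist_triangle) auto
  then have "mdist X y z \<le> 2 * r"
    using yz mdist_commute[of X y x] by auto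
  then show "ennreal (mdist X y z) \<le> ennreal (2 * r)"
    by (rule ennreal_leI)
qed

lemma subset_mball_of:
  assumes "W \<subseteq> mspace X" and "x \<in> W" and "diam X W < ennreal r"
  shows "W \<subseteq> mball_of X x r"
proof
  fix y
  assume y: "y \<in> W"
  have "ennreal (mdist X x y) < ennreal r"
    using mdist_le_diam[OF \<open>x \<in> W\<close> y] assms(3) by (rule le_less_trans)
  then have "mdist X x y < r"
    by (simp add: ennreal_less_iff)
  then show "y \<in> mball_of X x r"
    using assms y by auto
qed

text \<open>Handles isolated points: a set of diameter 0 has no second point, so it fits inside any
  set that meets it.\<close>

lemma diam_eq_0_imp_eq:
  assumes "S \<subseteq> mspace X" and "diam X S = 0" and "x \<in> S" and "y \<in> S"
  shows "x = y"
proof -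
  have "ennreal (mdist X x y) \<le> 0"
    using mdist_le_diam[OF assms(3,4), of X] assms(2) by simp
  \<comment> \<open>\<open>ennreal\<close> sends every negative real to 0, so the bound gives
    equality only together with nonnegativity of the metric.\<close>
  then have "mdist X x y = 0"
    using mdist_nonneg[of X x y] by (simp add: ennreal_eq_0_iff order_antisym)
  then show ?thesis
    using mdist_zero[of x X y] assms by blast
qed

lemma exists_small_openin:
  assumes "openin (mtopology_of X) W" and "x \<in> W" and "e > 0"
  shows "\<exists>V. openin (mtopology_of X) V \<and> x \<in> V \<and> V \<subseteq> W \<and> diam X V < ennreal e"
proof (intro exI conjI)
  \<comment> \<open>A ball of radius r can have diameter up to 2r; radius \<open>e / 3\<close>
    leaves room for the strict bound.\<close>
  let ?V = "W \<inter> mball_of X x (e / 3)"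
  show "openin (mtopology_of X) ?V"
    by (intro openin_Int assms openin_mball_of)
  have "x \<in> mspace X"
    using assms(1,2) by (auto simp: openin_mtopology_of)
  moreover from this have "mdist X x x = 0"
    by (subst mdist_zero) auto
  ultimately show "x \<in> ?V"
    using assms(2,3) by (simp del: mdist_zero)
  show "?V \<subseteq> W"
    by blast
  have "diam X ?V \<le> ennreal (2 * (e / 3))"
    by (rule order_trans[OF diam_mono diam_mball_of_le]) blast
  also have "\<dots> < ennreal e"
    using \<open>e > 0\<close> by (simp add: ennreal_less_iff)
  finally show "diam X ?V < ennreal e" .
qed

section \<open>From the selection principle to small basis elements\<close>

lemma small_basis_elements_cover:
  assumes "basis_of_topology (mtopology_of X) \<B>" and "e > 0"
  shows "{B \<in> \<B>. diam X B < ennreal e} \<in> open_covers (mtopology_of X)"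
proof -
  have op: "\<forall>B\<in>\<B>. openin (mtopology_of X) B"
    using assms(1) by (simp add: basis_of_topology_iff)
  have "\<exists>B\<in>\<B>. diam X B < ennreal e \<and> x \<in> B" if x: "x \<in> topspace (mtopology_of X)" for x
  proof -
    obtain V where V: "openin (mtopology_of X) V" "x \<in> V" "diam X V < ennreal e"
      using exists_small_openin[OF openin_topspace x \<open>e > 0\<close>] by blast
    then obtain B where "B \<in> \<B>" "x \<in> B" "B \<subseteq> V"
      using assms(1) unfolding basis_of_topology_iff by blast
    then show ?thesis
      using V(3) diam_mono le_less_trans by blast
  qed
  then show ?thesis
    using op by (auto simp: in_open_covers_iff)
qed

text \<open>For each \<open>n\<close>, the basis elements of diameter below
  \<open>\<epsilon> n\<close> form an open cover; a selection from these covers is already the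
  required sequence.\<close>

lemma S_one_imp_M_prime:
  assumes "S_one (open_covers (mtopology_of X)) (open_covers_of_subset (mtopology_of X) Y)"
  shows "M_prime X Y"
  unfolding M_prime_def
proof (intro allI impI)
  fix \<B> and \<epsilon> :: "nat \<Rightarrow> real"
  assume *: "basis_of_topology (mtopology_of X) \<B> \<and> (\<forall>n. \<epsilon> n > 0)"
  then have "\<forall>n. {B \<in> \<B>. diam X B < ennreal (\<epsilon> n)} \<in> open_covers (mtopology_of X)"
    by (auto intro: small_basis_elements_cover)
  then obtain B where "\<forall>n. B n \<in> {B \<in> \<B>. diam X B < ennreal (\<epsilon> n)}"
      and "range B \<in> open_covers_of_subset (mtopology_of X) Y"
    using assms unfolding S_one_def by meson
  then show "\<exists>B. (\<forall>n. B n \<in> \<B> \<and> diam X (B n) < ennreal (\<epsilon> n)) \<and> Y \<subseteq> (\<Union>n. B n)"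
    unfolding open_covers_of_subset_def by auto
qed

section \<open>From small basis elements to the selection principle\<close>

lemma finite_ennreal_positive_lower_bound:
  fixes A :: "ennreal set"
  assumes "finite A" and "0 \<notin> A"
  shows "\<exists>e::real. e > 0 \<and> (\<forall>a\<in>A. ennreal e \<le> a)"
  using assms
proof induction
  case empty
  show ?case by (auto intro: exI[of _ 1])
next
  case (insert a A)
  then obtain e where e: "e > 0" "\<forall>a\<in>A. ennreal e \<le> a"
    by auto
  obtain d :: real where d: "d > 0" "ennreal d \<le> a"
  proof (cases a)
    case (real r)
    then show ?thesis
      using that[of r] insert.prems by (cases "r = 0") auto
  next
    \<comment> \<open>An infinite value lies above every real, so any positive \<open>d\<close> will
      do.\<close>
    case top
    then show ?thesis
      using that[of 1] by simp
  qed
  have "ennreal (min d e) \<le> ennreal d" "ennreal (min d e) \<le> ennreal e"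
    by (auto intro: ennreal_leI)
  then have "\<forall>b\<in>insert a A. ennreal (min d e) \<le> b"
    using d e by (blast intro: order_trans)
  then show ?case
    using d(1) e(1) by (intro exI[of _ "min d e"]) auto
qed

text \<open>One application of \<open>S_fin\<close> guarantees only one index per point. Applied to
  the tail from \<open>j\<close>, it gives an index at least \<open>j\<close>; merging all tails
  keeps each family finite, because only tails with \<open>j \<le> n\<close> reach index
  \<open>n\<close>.\<close>

lemma S_fin_infinitely_often:
  fixes \<W> :: "nat \<Rightarrow> 'a set set"
  assumes "S_fin (open_covers T) (open_covers T)" and "\<And>n. \<W> n \<in> open_covers T"
  shows "\<exists>\<F>. (\<forall>n. finite (\<F> n) \<and> \<F> n \<subseteq> \<W> n) \<and>
    (\<forall>x\<in>topspace T. \<forall>j. \<exists>n\<ge>j. x \<in> \<Union>(\<F> n))"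
proof -
  have "\<exists>\<G>. (\<forall>n. finite (\<G> n) \<and> \<G> n \<subseteq> \<W> (j + n)) \<and> (\<Union>n. \<G> n) \<in> open_covers T" for j
    using assms(1)[unfolded S_fin_def, rule_format, of "\<lambda>n. \<W> (j + n)"] assms(2) by blast
  then obtain \<G> where \<G>: "\<And>j n. finite (\<G> j n)" "\<And>j n. \<G> j n \<subseteq> \<W> (j + n)"
      "\<And>j. (\<Union>n. \<G> j n) \<in> open_covers T"
    by metis
  \<comment> \<open>In the tail from \<open>j\<close>, the cover \<open>\<W> n\<close> sits at
    position \<open>n - j\<close>; the range \<open>j \<le> n\<close> keeps the natural subtraction
    exact.\<close>
  define \<F> where "\<F> n = (\<Union>j\<le>n. \<G> j (n - j))" for n
  have "finite (\<F> n)" for n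
    unfolding \<F>_def using \<G>(1) by auto
  moreover have "\<F> n \<subseteq> \<W> n" for n
    unfolding \<F>_def using \<G>(2) by (metis UN_least atMost_iff le_add_diff_inverse)
  moreover have "\<exists>n\<ge>j. x \<in> \<Union>(\<F> n)" if x: "x \<in> topspace T" for x j
  proof -
    obtain n where "x \<in> \<Union>(\<G> j n)"
      using x \<G>(3)[of j] unfolding in_open_covers_iff by blast
    moreover have "\<G> j n \<subseteq> \<F> (j + n)"
      unfolding \<F>_def by (rule UN_upper[of j, THEN subset_trans[rotated]]) auto
    ultimately show ?thesis
      by (intro exI[of _ "j + n"]) auto
  qed
  ultimately show ?thesis
    by (intro exI[of _ \<F>] conjI allI ballI)
qed

text \<open>Around a point, choose one member from each of the finitely many covers; their
  intersection is open and contains a small neighbourhood of the point.\<close>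

lemma small_common_refinement:
  fixes \<U> :: "nat \<Rightarrow> 'a set set"
  assumes "\<And>k. \<U> k \<in> open_covers (mtopology_of X)" and "e > 0"
  shows "{W. openin (mtopology_of X) W \<and> W \<noteq> {} \<and> diam X W < ennreal e \<and>
    (\<forall>k\<le>m. \<exists>U\<in>\<U> k. W \<subseteq> U)} \<in> open_covers (mtopology_of X)" (is "?\<W> \<in> _")
proof -
  have "\<exists>W\<in>?\<W>. x \<in> W" if x: "x \<in> topspace (mtopology_of X)" for x
  proof -
    have "\<exists>U\<in>\<U> k. openin (mtopology_of X) U \<and> x \<in> U" for k
      using assms(1)[of k] x unfolding in_open_covers_iff by blast
    then obtain U where U: "\<And>k. U k \<in> \<U> k" "\<And>k. openin (mtopology_of X) (U k)" "\<And>k. x \<in> U k"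
      by metis
    have "openin (mtopology_of X) (\<Inter>k\<in>{..m}. U k)"
      by (rule openin_INT2) (use U(2) in auto)
    moreover have "x \<in> (\<Inter>k\<in>{..m}. U k)"
      using U(3) by blast
    ultimately obtain V where "openin (mtopology_of X) V" "x \<in> V" "V \<subseteq> (\<Inter>k\<in>{..m}. U k)"
        "diam X V < ennreal e"
      using exists_small_openin[OF _ _ \<open>e > 0\<close>] by metis
    then show ?thesis
      using U(1) by (intro bexI[of _ V]) auto
  qed
  then show ?thesis
    by (auto simp: in_open_covers_iff simp del: topspace_mtopology_of)
qed

text \<open>An open set around \<open>x\<close> contains a ball about \<open>x\<close>, and any set
  through \<open>x\<close> of diameter below the radius lies in that ball. Covering \<open>x\<close>
  at arbitrarily late stages supplies such a set.\<close>

lemma basis_of_topology_if_diam_tendsto_0: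
  assumes op: "\<And>m W. W \<in> \<F> m \<Longrightarrow> openin (mtopology_of X) W"
    and diam: "\<And>m W. W \<in> \<F> m \<Longrightarrow> diam X W < ennreal (\<delta> m)"
    and \<delta>: "\<delta> \<longlonglongrightarrow> 0"
    and often: "\<And>x j. x \<in> mspace X \<Longrightarrow> \<exists>m\<ge>j. x \<in> \<Union>(\<F> m)"
  shows "basis_of_topology (mtopology_of X) (\<Union>m. \<F> m)"
  unfolding basis_of_topology_iff
proof (intro conjI allI impI)
  show "\<forall>B\<in>\<Union>m. \<F> m. openin (mtopology_of X) B"
    using op by blast
next
  fix V x
  assume V: "openin (mtopology_of X) V \<and> x \<in> V"
  then obtain r where r: "r > 0" "mball_of X x r \<subseteq> V" and x: "x \<in> mspace X"
    by (metis openin_mtopology_of subsetD)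
  from \<delta> r(1) have "\<forall>\<^sub>F m in sequentially. \<delta> m < r"
    by (rule order_tendstoD)
  then obtain j where j: "\<And>m. m \<ge> j \<Longrightarrow> \<delta> m < r"
    by (auto simp: eventually_sequentially)
  obtain m W where W: "m \<ge> j" "W \<in> \<F> m" "x \<in> W"
    using often[OF x] by blast
  have "diam X W < ennreal r"
    using diam[OF W(2)] j[OF W(1)] by (meson ennreal_leI less_imp_le less_le_trans)
  then have "W \<subseteq> V"
    using subset_mball_of[OF _ W(3)] op[OF W(2)] r(2)
    by (auto simp: openin_mtopology_of)
  then show "\<exists>B\<in>\<Union>m. \<F> m. x \<in> B \<and> B \<subseteq> V"
    using W by blast
qed

lemma M_prime_imp_S_one:
  assumes menger: "S_fin (open_covers (mtopology_of X)) (open_covers (mtopology_of X))"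
    and "M_prime X Y"
  shows "S_one (open_covers (mtopology_of X)) (open_covers_of_subset (mtopology_of X) Y)"
  unfolding S_one_def
proof (intro allI impI)
  let ?T = "mtopology_of X"
  fix \<U> :: "nat \<Rightarrow> 'a set set"
  assume \<U>: "\<forall>n. \<U> n \<in> open_covers ?T"
  \<comment> \<open>Nonemptiness provides the point used below for diameter 0. It matters for an
    empty space, where \<open>\<U> n\<close> may have no member to contain an empty basis
    element.\<close>
  define \<W> where "\<W> m = {W. openin ?T W \<and> W \<noteq> {} \<and> diam X W < ennreal (1 / real (Suc m)) \<and>
    (\<forall>k\<le>m. \<exists>U\<in>\<U> k. W \<subseteq> U)}" for m
  have "\<W> m \<in> open_covers ?T" for m
    unfolding \<W>_def using \<U> by (intro small_common_refinement) auto
  then obtain \<F> where \<F>: "\<And>m. finite (\<F> m)" "\<And>m. \<F> m \<subseteq> \<W> m"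
      and often: "\<And>x j. x \<in> mspace X \<Longrightarrow> \<exists>m\<ge>j. x \<in> \<Union>(\<F> m)"
    using S_fin_infinitely_often[OF menger, of \<W>] unfolding topspace_mtopology_of by metis
  have basis: "basis_of_topology ?T (\<Union>m. \<F> m)"
  proof (rule basis_of_topology_if_diam_tendsto_0[OF _ _ _ often])
    show "openin ?T W" "diam X W < ennreal (1 / real (Suc m))" if "W \<in> \<F> m" for m W
      using that \<F>(2)[of m] unfolding \<W>_def by auto
    show "(\<lambda>m. 1 / real (Suc m)) \<longlonglongrightarrow> 0"
      using LIMSEQ_inverse_real_of_nat by (simp add: inverse_eq_divide)
  qed
  \<comment> \<open>Diameter 0 can occur at isolated points and would rule out a positive lower
    bound, so it is removed here and treated separately. For \<open>n = 0\<close> the set is empty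
    and any positive \<open>e\<close> works.\<close>
  have "\<exists>e::real. e > 0 \<and> (\<forall>a\<in>diam X ` (\<Union>m<n. \<F> m) - {0}. ennreal e \<le> a)" for n
    using \<F>(1) by (intro finite_ennreal_positive_lower_bound) auto
  then obtain \<epsilon> :: "nat \<Rightarrow> real" where \<epsilon>: "\<And>n. \<epsilon> n > 0"
      "\<And>n a. a \<in> diam X ` (\<Union>m<n. \<F> m) - {0} \<Longrightarrow> ennreal (\<epsilon> n) \<le> a"
    by metis
  have refine: "\<exists>U\<in>\<U> n. B \<subseteq> U" if B: "B \<in> (\<Union>m. \<F> m)" "diam X B < ennreal (\<epsilon> n)" for B n
  proof -
    obtain m where m: "B \<in> \<F> m"
      using B(1) by blast
    then have BW: "B \<in> \<W> m"
      using \<F>(2) by blast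
    show ?thesis
    proof (cases "n \<le> m")
      case True
      then show ?thesis
        using BW unfolding \<W>_def by blast
    next
      case False
      \<comment> \<open>Now \<open>m < n\<close>, so \<open>\<epsilon> n\<close> bounds the diameter
        of \<open>B\<close> from below unless that diameter is 0; the strict upper bound leaves only
        0.\<close>
      then have "diam X B \<in> diam X ` (\<Union>m<n. \<F> m)"
        using m by (intro imageI UN_I[of m]) auto
      then have zero: "diam X B = 0"
        using \<epsilon>(2)[of "diam X B" n] B(2) by (meson DiffI leD singletonD)
      have sub: "B \<subseteq> mspace X" and "B \<noteq> {}"
        using BW openin_subset[of ?T B] unfolding \<W>_def by auto
      then obtain x where x: "x \<in> B" "x \<in> mspace X"
        by blast
      then obtain U where U: "U \<in> \<U> n" "x \<in> U"
        using \<U>[rule_format, of n] unfolding in_open_covers_iff by auto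
      \<comment> \<open>\<open>B\<close> is the singleton of \<open>x\<close>, so a member of
        \<open>\<U> n\<close> through \<open>x\<close> contains it.\<close>
      have "B \<subseteq> U"
        using diam_eq_0_imp_eq[OF sub zero x(1)] U(2) by auto
      with U(1) show ?thesis ..
    qed
  qed
  have "\<exists>B. (\<forall>n. B n \<in> (\<Union>m. \<F> m) \<and> diam X (B n) < ennreal (\<epsilon> n)) \<and> Y \<subseteq> (\<Union>n. B n)"
    using \<open>M_prime X Y\<close>[unfolded M_prime_def, THEN spec, THEN spec, THEN mp, of "\<Union>m. \<F> m" \<epsilon>]
      basis \<epsilon>(1) by (simp only: simp_thms)
  then obtain B where B: "\<And>n. B n \<in> (\<Union>m. \<F> m)" "\<And>n. diam X (B n) < ennreal (\<epsilon> n)"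
      and Y: "Y \<subseteq> (\<Union>n. B n)"
    by metis
  have "\<exists>U\<in>\<U> n. B n \<subseteq> U" for n
    by (rule refine[OF B])
  then obtain U where U: "\<And>n. U n \<in> \<U> n" "\<And>n. B n \<subseteq> U n"
    by metis
  show "\<exists>U. (\<forall>n. U n \<in> \<U> n) \<and> range U \<in> open_covers_of_subset ?T Y"
  proof (intro exI conjI allI)
    have "openin ?T (U n)" for n
      using U(1)[of n] \<U>[rule_format, of n] unfolding in_open_covers_iff by blast
    moreover have "(\<Union>n. B n) \<subseteq> (\<Union>n. U n)"
      using U(2) by (rule UN_mono[OF subset_refl])
    ultimately show "range U \<in> open_covers_of_subset ?T Y"
      using Y by (auto simp: open_covers_of_subset_def)
  qed (rule U(1))
qed

theorem theoremA:
  fixes X :: "'a metric" and Y :: "'a set"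
  assumes "S_fin (open_covers (mtopology_of X)) (open_covers (mtopology_of X))"
    and "Y \<subseteq> mspace X"
  shows "S_one (open_covers (mtopology_of X)) (open_covers_of_subset (mtopology_of X) Y)
    \<longleftrightarrow> M_prime X Y"
  using S_one_imp_M_prime M_prime_imp_S_one[OF assms(1)] by (rule iffI)

end
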